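(* Consider a $2\times2$ traffic game with identical players, $\beta_1=\beta_2=\beta>0$. Let $\theta(w)=\beta\varphi(w)$ and $\psi=\theta\circ\theta$, let $\bar w$ be the unique fixed point of $\theta$, and let $\bar x$ be the symmetric rest point associated with $\bar w$. (a) If $\psi'(\bar w)\le1$ then $\bar w$ is the only fixed point of $\psi$ and $\bar x$ is the unique rest point of the mean field dynamics. This rest point is stable if and only if $\psi'(\bar w)<1$. (b) If $\psi'(\bar w)>1$ then $\psi$ has exactly three fixed points $w^1<\bar w<w^2$, with $w^1=\theta(w^2)$ and $w^2=\theta(w^1)$, and $$\psi'(w^1)=\psi'(w^2)=\theta'(w^1)\,\theta'(w^2)<1 .$$ The symmetric rest point $\bar x$ is unstable and there are two stable non-symmetric rest points: one defined by $\pi^{1a}=\rho(w^1)$, $\pi^{2a}=\rho(w^2)$, and the other one with the identities of the players exchanged.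
   Context: $2\times2$ traffic game with identical players: players $i\in\{1,2\}$, routes $r\in\{a,b\}$, real travel times $C_1^r\le C_2^r$ for each route $r$, and a common parameter $\beta>0$. The state is $x=(x^{1a},x^{1b},x^{2a},x^{2b})\in\mathbb{R}^4$, with $x^i=(x^{ia},x^{ib})$. Logit probabilities: $\pi^{ir}(x^i)=\dfrac{e^{-\beta x^{ir}}}{e^{-\beta x^{ia}}+e^{-\beta x^{ib}}}$. Put $\delta^r=C_2^r-C_1^r\ge 0$ and $\delta=\delta^a+\delta^b$. With $j\ne i$ the other player, $C^{ir}(x^{j})=C_1^r+\delta^r\,\pi^{jr}(x^j)$. Mean field dynamics: $\dot x^{ir}=G^{ir}(x):=\pi^{ir}(x^i)\,\bigl(C^{ir}(x^{j})-x^{ir}\bigr)$ for $i\in\{1,2\}$, $r\in\{a,b\}$, $j\neq i$. A rest point is an $x$ with $x^{ir}=C^{ir}(x^j)$ for all $i,r$. A rest point is called stable if all eigenvalues of the Jacobian matrix of $G$ at $x$ have strictly negative real part, and unstable if it is not stable in this sense. A rest point is symmetric if $x^{1a}=x^{2a}$ and $x^{1b}=x^{2b}$. Let $\kappa=C_1^a-C_2^b$, $\rho(w)=1/(1+e^{w})$, $\varphi(w)=\kappa+\delta\rho(w)$. The function $\theta=\beta\varphi$ is non-increasing and bounded, so it has a unique fixed point $\bar w$. A rest point is determined by the Logit probabilities $p_1=\pi^{1a}$, $p_2=\pi^{2a}$ through $x^{1a}=C_1^a+\delta^a p_2$, $x^{1b}=C_2^b-\delta^b p_2$, $x^{2a}=C_1^a+\delta^a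 p_1$, $x^{2b}=C_2^b-\delta^b p_1$; the symmetric rest point $\bar x$ is the one with $p_1=p_2=\rho(\bar w)$. *)

theory Defs
  imports "HOL-Analysis.Analysis"
begin

datatype player = Player1 | Player2
datatype route = Route_a | Route_b

lemma UNIV_player: "UNIV = {Player1, Player2}"
  using player.exhaust by auto

lemma UNIV_route: "UNIV = {Route_a, Route_b}"
  using route.exhaust by auto

instance player :: finite
  by standard (simp add: UNIV_player)

instance route :: finite
  by standard (simp add: UNIV_route)

fun other :: "player \<Rightarrow> player" where
  "other Player1 = Player2"
| "other Player2 = Player1"

(* The state space is R^4 with coordinates indexed by pairs (player, route). *)
type_synonym state = "real ^ (player \<times> route)"


section \<open>Mean field dynamics and rest points\<close>

definition logit :: "real \<Rightarrow> state \<Rightarrow> player \<Rightarrow> route \<Rightarrow> real" where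
  "logit \<beta> x i r =
     exp (- \<beta> * x $ (i, r)) / (exp (- \<beta> * x $ (i, Route_a)) + exp (- \<beta> * x $ (i, Route_b)))"

definition dlt :: "(route \<Rightarrow> real) \<Rightarrow> (route \<Rightarrow> real) \<Rightarrow> route \<Rightarrow> real" where
  "dlt C1 C2 r = C2 r - C1 r"

definition dlt_total :: "(route \<Rightarrow> real) \<Rightarrow> (route \<Rightarrow> real) \<Rightarrow> real" where
  "dlt_total C1 C2 = dlt C1 C2 Route_a + dlt C1 C2 Route_b"

definition cost ::
  "(route \<Rightarrow> real) \<Rightarrow> (route \<Rightarrow> real) \<Rightarrow> real \<Rightarrow> state \<Rightarrow> player \<Rightarrow> route \<Rightarrow> real" where
  "cost C1 C2 \<beta> x i r = C1 r + dlt C1 C2 r * logit \<beta> x (other i) r"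

definition mean_field ::
  "(route \<Rightarrow> real) \<Rightarrow> (route \<Rightarrow> real) \<Rightarrow> real \<Rightarrow> state \<Rightarrow> state" where
  "mean_field C1 C2 \<beta> x =
     (\<chi> k. case k of (i, r) \<Rightarrow> logit \<beta> x i r * (cost C1 C2 \<beta> x i r - x $ (i, r)))"

definition rest_point ::
  "(route \<Rightarrow> real) \<Rightarrow> (route \<Rightarrow> real) \<Rightarrow> real \<Rightarrow> state \<Rightarrow> bool" where
  "rest_point C1 C2 \<beta> x \<longleftrightarrow> (\<forall>i r. x $ (i, r) = cost C1 C2 \<beta> x i r)"

definition complex_eigenvalue :: "real ^ 'n ^ 'n \<Rightarrow> complex \<Rightarrow> bool" where
  "complex_eigenvalue M l \<longleftrightarrow>
     (\<exists>v :: complex ^ 'n. v \<noteq> 0 \<and> map_matrix complex_of_real M *v v = l *s v)"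

definition stable_rest_point ::
  "(route \<Rightarrow> real) \<Rightarrow> (route \<Rightarrow> real) \<Rightarrow> real \<Rightarrow> state \<Rightarrow> bool" where
  "stable_rest_point C1 C2 \<beta> x \<longleftrightarrow>
     rest_point C1 C2 \<beta> x \<and>
     (\<forall>l. complex_eigenvalue (jacobian (mean_field C1 C2 \<beta>) (at x)) l \<longrightarrow> Re l < 0)"

definition unstable_rest_point ::
  "(route \<Rightarrow> real) \<Rightarrow> (route \<Rightarrow> real) \<Rightarrow> real \<Rightarrow> state \<Rightarrow> bool" where
  "unstable_rest_point C1 C2 \<beta> x \<longleftrightarrow>
     rest_point C1 C2 \<beta> x \<and> \<not> stable_rest_point C1 C2 \<beta> x"

definition symmetric_state :: "state \<Rightarrow> bool" where
  "symmetric_state x \<longleftrightarrow> (\<forall>r. x $ (Player1, r) = x $ (Player2, r))"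

definition swap_players :: "state \<Rightarrow> state" where
  "swap_players x = (\<chi> k. case k of (i, r) \<Rightarrow> x $ (other i, r))"

(* The entries of jacobian are the genuine partial derivatives of mean_field. *)
lemma mean_field_differentiable: "mean_field C1 C2 \<beta> differentiable (at x)"
proof -
  have pos: "exp (- \<beta> * y $ (i, Route_a)) + exp (- \<beta> * y $ (i, Route_b)) \<noteq> 0"
    for y :: state and i
    by (smt (verit) exp_gt_zero)
  have nth: "(\<lambda>y :: state. y $ k) differentiable (at x)" for k
    by (intro linear_imp_differentiable bounded_linear.linear bounded_linear_vec_nth)
  have ex: "(\<lambda>y :: state. exp (- \<beta> * y $ k)) differentiable (at x)" for k
  proof -
    have "((\<lambda>y :: state. exp (- \<beta> * y $ k)) has_derivative
            (\<lambda>h. exp (- \<beta> * x $ k) * (- \<beta> * h $ k))) (at x)"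
      by (auto intro!: derivative_eq_intros bounded_linear.has_derivative[OF bounded_linear_vec_nth])
    then show ?thesis
      by (rule differentiableI)
  qed
  have lg: "(\<lambda>y. logit \<beta> y i r) differentiable (at x)" for i r
    unfolding logit_def using pos
    by (intro differentiable_divide differentiable_add ex) auto
  have "(\<lambda>y. mean_field C1 C2 \<beta> y $ k) differentiable (at x)" for k
    by (cases k) (auto simp: mean_field_def cost_def
        intro!: differentiable_mult differentiable_add differentiable_diff differentiable_const lg nth)
  then show ?thesis
    by (subst differentiable_componentwise_within) (auto simp: Basis_vec_def inner_axis)
qed


section \<open>The scalar fixed point problem\<close>

definition kappa :: "(route \<Rightarrow> real) \<Rightarrow> (route \<Rightarrow> real) \<Rightarrow> real" where
  "kappa C1 C2 = C1 Route_a - C2 Route_b"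

definition rho :: "real \<Rightarrow> real" where
  "rho w = 1 / (1 + exp w)"

definition phi :: "(route \<Rightarrow> real) \<Rightarrow> (route \<Rightarrow> real) \<Rightarrow> real \<Rightarrow> real" where
  "phi C1 C2 w = kappa C1 C2 + dlt_total C1 C2 * rho w"

definition theta :: "(route \<Rightarrow> real) \<Rightarrow> (route \<Rightarrow> real) \<Rightarrow> real \<Rightarrow> real \<Rightarrow> real" where
  "theta C1 C2 \<beta> w = \<beta> * phi C1 C2 w"

definition psi :: "(route \<Rightarrow> real) \<Rightarrow> (route \<Rightarrow> real) \<Rightarrow> real \<Rightarrow> real \<Rightarrow> real" where
  "psi C1 C2 \<beta> = theta C1 C2 \<beta> \<circ> theta C1 C2 \<beta>"

definition wbar :: "(route \<Rightarrow> real) \<Rightarrow> (route \<Rightarrow> real) \<Rightarrow> real \<Rightarrow> real" where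
  "wbar C1 C2 \<beta> = (THE w. theta C1 C2 \<beta> w = w)"

(* The state determined by the probabilities p1, p2 with which the two players
   use Route_a: each player's coordinates depend on the other player's probability. *)
definition state_of_probs ::
  "(route \<Rightarrow> real) \<Rightarrow> (route \<Rightarrow> real) \<Rightarrow> real \<Rightarrow> real \<Rightarrow> state" where
  "state_of_probs C1 C2 p1 p2 =
     (\<chi> k. case k of
        (Player1, Route_a) \<Rightarrow> C1 Route_a + dlt C1 C2 Route_a * p2
      | (Player1, Route_b) \<Rightarrow> C2 Route_b - dlt C1 C2 Route_b * p2
      | (Player2, Route_a) \<Rightarrow> C1 Route_a + dlt C1 C2 Route_a * p1
      | (Player2, Route_b) \<Rightarrow> C2 Route_b - dlt C1 C2 Route_b * p1)"

definition xbar :: "(route \<Rightarrow> real) \<Rightarrow> (route \<Rightarrow> real) \<Rightarrow> real \<Rightarrow> state" where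
  "xbar C1 C2 \<beta> =
     state_of_probs C1 C2 (rho (wbar C1 C2 \<beta>)) (rho (wbar C1 C2 \<beta>))"

lemma rho_bounds: "0 < rho w" "rho w < 1"
  by (auto simp: rho_def add_pos_pos)

lemma rho_antimono: "v \<le> w \<Longrightarrow> rho w \<le> rho v"
  by (auto simp: rho_def intro!: divide_left_mono add_pos_pos mult_pos_pos)

(* The description operator in wbar is well defined. *)
lemma theta_ex1_fixed_point:
  assumes "\<And>r. C1 r \<le> C2 r" and "\<beta> > 0"
  shows "\<exists>!w. theta C1 C2 \<beta> w = w"
proof -
  have d: "dlt_total C1 C2 \<ge> 0"
    using assms(1) by (simp add: dlt_total_def dlt_def)
  have anti: "theta C1 C2 \<beta> w \<le> theta C1 C2 \<beta> v" if "v \<le> w" for v w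
    using rho_antimono[OF that] d assms(2)
    by (auto simp: theta_def phi_def intro!: mult_left_mono)
  define lo hi where "lo = \<beta> * kappa C1 C2" and "hi = \<beta> * (kappa C1 C2 + dlt_total C1 C2)"
  have lo: "lo \<le> theta C1 C2 \<beta> w" for w
    using rho_bounds(1)[of w] d assms(2)
    by (auto simp: theta_def phi_def lo_def intro!: mult_left_mono)
  have hi: "theta C1 C2 \<beta> w \<le> hi" for w
    using rho_bounds(2)[of w] d assms(2)
    by (auto simp: theta_def phi_def hi_def intro!: mult_left_mono mult_left_le)
  have nz: "1 + exp w \<noteq> 0" for w :: real
    by (smt (verit) exp_gt_zero)
  have "continuous_on {lo..hi} (\<lambda>w. w - theta C1 C2 \<beta> w)"
    unfolding theta_def phi_def rho_def using nz by (intro continuous_intros) auto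
  then obtain w where "w - theta C1 C2 \<beta> w = 0"
    using IVT'[of "\<lambda>w. w - theta C1 C2 \<beta> w" lo 0 hi] lo[of lo] hi[of hi] lo[of hi] hi[of lo]
    by auto
  then have "theta C1 C2 \<beta> w = w"
    by simp
  moreover have "v = w" if "theta C1 C2 \<beta> v = v" "theta C1 C2 \<beta> w = w" for v w
    using anti[of v w] anti[of w v] that by linarith
  ultimately show ?thesis
    by blast
qed

lemma theta_wbar:
  assumes "\<And>r. C1 r \<le> C2 r" and "\<beta> > 0"
  shows "theta C1 C2 \<beta> (wbar C1 C2 \<beta>) = wbar C1 C2 \<beta>"
  unfolding wbar_def by (rule theI') (rule theta_ex1_fixed_point[OF assms])

lemma xbar_symmetric: "symmetric_state (xbar C1 C2 \<beta>)"
  by (auto simp: symmetric_state_def xbar_def state_of_probs_def split: route.split)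

lemma logit_route_a: "logit \<beta> x i Route_a = rho (\<beta> * (x $ (i, Route_a) - x $ (i, Route_b)))"
proof -
  have frac: "u / (u + v) = 1 / (1 + v / u)" if "u > 0" "v > 0" for u v :: real
    using that by (simp add: field_simps)
  have "exp (\<beta> * (x $ (i, Route_a) - x $ (i, Route_b))) =
          exp (- \<beta> * x $ (i, Route_b)) / exp (- \<beta> * x $ (i, Route_a))"
    by (simp add: algebra_simps flip: exp_diff)
  then show ?thesis
    unfolding logit_def rho_def by (simp only: frac exp_gt_zero)
qed

lemma logit_route_b: "logit \<beta> x i Route_b = 1 - logit \<beta> x i Route_a"
proof -
  have "exp (- \<beta> * x $ (i, Route_a)) + exp (- \<beta> * x $ (i, Route_b)) \<noteq> 0"
    by (smt (verit) exp_gt_zero)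
  then show ?thesis
    by (simp add: logit_def field_simps)
qed

lemma xbar_rest_point:
  assumes "\<And>r. C1 r \<le> C2 r" and "\<beta> > 0"
  shows "rest_point C1 C2 \<beta> (xbar C1 C2 \<beta>)"
    and "logit \<beta> (xbar C1 C2 \<beta>) i Route_a = rho (wbar C1 C2 \<beta>)"
proof -
  have *: "logit \<beta> (xbar C1 C2 \<beta>) i Route_a = rho (wbar C1 C2 \<beta>)" for i
  proof -
    have "xbar C1 C2 \<beta> $ (i, Route_a) - xbar C1 C2 \<beta> $ (i, Route_b) = phi C1 C2 (wbar C1 C2 \<beta>)"
      by (cases i) (auto simp: xbar_def state_of_probs_def phi_def kappa_def dlt_total_def algebra_simps)
    then show ?thesis
      using theta_wbar[OF assms] by (simp add: logit_route_a theta_def)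
  qed
  then show "logit \<beta> (xbar C1 C2 \<beta>) i Route_a = rho (wbar C1 C2 \<beta>)" .
  show "rest_point C1 C2 \<beta> (xbar C1 C2 \<beta>)"
    unfolding rest_point_def
  proof (intro allI)
    fix i r
    show "xbar C1 C2 \<beta> $ (i, r) = cost C1 C2 \<beta> (xbar C1 C2 \<beta>) i r"
      by (cases i; cases r)
        (simp_all add: cost_def logit_route_b *,
         simp_all add: xbar_def state_of_probs_def dlt_def algebra_simps)
  qed
qed

end

theory Submission
  imports Defs
begin

text \<open>
  The argument has two parts: a convexity argument that counts the fixed points of \<open>\<psi> = \<theta> \<circ> \<theta>\<close>, and a
  reading of the spectrum of the linearized dynamics in terms of \<open>\<psi>'\<close>.

  Counting. Let \<open>t = \<rho>(w)\<close>, \<open>z = \<theta>(w)\<close> and \<open>D = \<beta>\<delta>\<close>. Since \<open>\<rho>' = -\<rho>(1 - \<rho>)\<close> and \<open>1/(\<rho>(z)(1 - \<rho>(z))) =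
  2 + e\<^sup>z + e\<^sup>-\<^sup>z\<close>, one has \<open>\<psi>'(w) = D\<^sup>2 t(1 - t) / (2 + e\<^sup>z + e\<^sup>-\<^sup>z)\<close>. Hence \<open>\<psi>'(w) \<ge> 1\<close> says that
  \<open>2 + e\<^sup>z + e\<^sup>-\<^sup>z - D\<^sup>2 t(1 - t) \<le> 0\<close>, where \<open>z\<close> is affine in \<open>t\<close>, so that the left-hand side is a strictly
  convex function of \<open>t\<close> when \<open>D \<noteq> 0\<close>. Because \<open>\<rho>\<close> is strictly monotone, \<open>\<psi>' > 1\<close> holds strictly between
  any two points at which \<open>\<psi>' \<ge> 1\<close> (lemma \<open>deriv_psi_between\<close>). As there is a point with \<open>\<psi>' = 1\<close> between
  any two fixed points of \<open>\<psi>\<close>, a fourth fixed point is impossible, and of three fixed points the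
  middle one has slope above \<open>1\<close> and the smallest has slope below \<open>1\<close>. Since \<open>\<theta>\<close> reverses the order, it
  carries fixed points of \<open>\<psi>\<close> below \<open>\<omega>\<close> (its own fixed point) to fixed points above \<open>\<omega>\<close>. So the fixed
  points of \<open>\<psi>\<close> number either one or three, and the slope of \<open>\<psi>\<close> at \<open>\<omega>\<close> decides which.

  Rest points. At a rest point, \<open>w\<^sub>i = \<beta>(x\<^sup>i\<^sup>a - x\<^sup>i\<^sup>b)\<close> satisfies \<open>w\<^sub>1 = \<theta>(w\<^sub>2)\<close> and \<open>w\<^sub>2 = \<theta>(w\<^sub>1)\<close>; thus rest
  points correspond bijectively to fixed points of \<open>\<psi>\<close>, and exchanging the players corresponds to
  applying \<open>\<theta>\<close>.

  Stability. Let \<open>\<Lambda>\<close> be an eigenvalue at a rest point with eigenvector \<open>v\<close>, and let \<open>u\<^sub>i = v\<^sup>i\<^sup>a - v\<^sup>i\<^sup>b\<close>.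
  Solving the four equations for \<open>v\<close> gives \<open>u\<^sub>i = -s\<^sub>j g\<^sub>i(\<Lambda>) u\<^sub>j\<close> with \<open>s\<^sub>j = \<beta> \<pi>\<^sup>j\<^sup>a \<pi>\<^sup>j\<^sup>b\<close> and
  \<open>g\<^sub>i(\<Lambda>) = \<Sum>\<^sub>r \<pi>\<^sup>i\<^sup>r \<delta>\<^sup>r / (\<Lambda> + \<pi>\<^sup>i\<^sup>r)\<close>. If \<open>Re \<Lambda> \<ge> 0\<close> then \<open>|g\<^sub>i(\<Lambda>)| \<le> \<delta>\<close>, which forces \<open>v = 0\<close> as soon as
  \<open>\<delta>\<^sup>2 s\<^sub>1 s\<^sub>2 < 1\<close>. If \<open>\<delta>\<^sup>2 s\<^sub>1 s\<^sub>2 \<ge> 1\<close>, the intermediate value theorem yields a real \<open>\<Lambda> \<ge> 0\<close> with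
  \<open>s\<^sub>1 s\<^sub>2 g\<^sub>1(\<Lambda>) g\<^sub>2(\<Lambda>) = 1\<close>, and this \<open>\<Lambda>\<close> is an eigenvalue. As \<open>\<theta>'(w\<^sub>j) = -\<delta> s\<^sub>j\<close>, the number
  \<open>\<delta>\<^sup>2 s\<^sub>1 s\<^sub>2\<close> is \<open>\<psi>'\<close> at the corresponding fixed point, and the rest point is stable exactly when
  \<open>\<psi>' < 1\<close> there (lemma \<open>stable_fixed_point_state_iff\<close>).
\<close>

section \<open>The slope of the scalar map\<close>

locale traffic_game =
  fixes C1 C2 :: "route \<Rightarrow> real" and \<beta> :: real
  assumes C1_le_C2: "C1 r \<le> C2 r" and beta_pos: "\<beta> > 0"
begin

abbreviation \<theta> :: "real \<Rightarrow> real" where "\<theta> \<equiv> theta C1 C2 \<beta>"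
abbreviation \<psi> :: "real \<Rightarrow> real" where "\<psi> \<equiv> psi C1 C2 \<beta>"
abbreviation \<omega> :: real where "\<omega> \<equiv> wbar C1 C2 \<beta>"

lemma dlt_nonneg: "dlt C1 C2 r \<ge> 0"
  using C1_le_C2 by (simp add: dlt_def)

lemma dlt_total_nonneg: "dlt_total C1 C2 \<ge> 0"
  using dlt_nonneg by (simp add: dlt_total_def)

lemma theta_fixed: "\<theta> \<omega> = \<omega>"
  using C1_le_C2 beta_pos by (rule theta_wbar)

lemma theta_unique: "\<theta> w = w \<Longrightarrow> w = \<omega>"
  unfolding wbar_def using theta_ex1_fixed_point[OF C1_le_C2 beta_pos]
  by (rule the1_equality[symmetric])

lemma theta_antimono: "v \<le> w \<Longrightarrow> \<theta> w \<le> \<theta> v"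
  using rho_antimono[of v w] dlt_total_nonneg beta_pos
  by (auto simp: theta_def phi_def intro!: mult_left_mono)

lemma psi_fixed: "\<psi> \<omega> = \<omega>"
  by (simp add: psi_def theta_fixed)

lemma psi_fixed_theta: "\<psi> w = w \<Longrightarrow> \<psi> (\<theta> w) = \<theta> w"
  by (simp add: psi_def)

lemma rho_strict_antimono: "v < w \<Longrightarrow> rho w < rho v"
  by (auto simp: rho_def add_pos_pos intro!: divide_strict_left_mono mult_pos_pos)

lemma rho_inject: "rho v = rho w \<longleftrightarrow> v = w"
  using rho_strict_antimono[of v w] rho_strict_antimono[of w v] by (cases v w rule: linorder_cases) auto

lemma rho_variance: "1 / (rho w * (1 - rho w)) = 2 + exp w + exp (- w)"
proof -
  have "1 + exp w > 0" by (simp add: add_pos_pos)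
  then show ?thesis
    by (simp add: rho_def exp_minus field_simps)
qed

lemma rho_deriv: "(rho has_real_derivative - (rho w * (1 - rho w))) (at w)"
proof -
  have nz: "1 + exp w > 0" by (simp add: add_pos_pos)
  have "((\<lambda>w. 1 / (1 + exp w)) has_real_derivative - (rho w * (1 - rho w))) (at w)"
    using nz by (auto intro!: derivative_eq_intros simp: rho_def field_simps)
  then show ?thesis
    by (simp add: rho_def[abs_def])
qed

lemma theta_deriv:
  "(\<theta> has_real_derivative - (\<beta> * dlt_total C1 C2 * (rho w * (1 - rho w)))) (at w)"
  unfolding theta_def[abs_def] phi_def
  by (auto intro!: derivative_eq_intros rho_deriv)

lemma psi_deriv:
  "(\<psi> has_real_derivative deriv \<theta> (\<theta> w) * deriv \<theta> w) (at w)"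
proof -
  have "(\<theta> has_real_derivative deriv \<theta> v) (at v)" for v
    using theta_deriv[of v] by (simp add: DERIV_imp_deriv)
  then show ?thesis
    unfolding psi_def by (intro DERIV_chain)
qed

lemma deriv_theta: "deriv \<theta> w = - (\<beta> * dlt_total C1 C2 * (rho w * (1 - rho w)))"
  using theta_deriv by (rule DERIV_imp_deriv)

lemma deriv_psi: "deriv \<psi> w = deriv \<theta> (\<theta> w) * deriv \<theta> w"
  using psi_deriv by (rule DERIV_imp_deriv)

lemma psi_has_deriv: "(\<psi> has_real_derivative deriv \<psi> w) (at w)"
  using psi_deriv by (simp add: deriv_psi)

text \<open>The denominator of \<open>\<psi>'\<close> minus its numerator, as a function of \<open>t = \<rho>(w)\<close>: in this variable
  \<open>\<theta>(w)\<close> is affine, so the denominator is convex and the numerator concave.\<close>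
definition slope_gap :: "real \<Rightarrow> real" where
  "slope_gap t =
     2 + exp (\<beta> * (kappa C1 C2 + dlt_total C1 C2 * t)) + exp (- (\<beta> * (kappa C1 C2 + dlt_total C1 C2 * t)))
       - (\<beta> * dlt_total C1 C2)\<^sup>2 * (t * (1 - t))"

lemma deriv_psi_gap:
  "deriv \<psi> w - 1 = - slope_gap (rho w) * (rho (\<theta> w) * (1 - rho (\<theta> w)))"
proof -
  define V where "V = rho (\<theta> w) * (1 - rho (\<theta> w))"
  have nz: "V \<noteq> 0"
    using rho_bounds(1)[of "\<theta> w"] rho_bounds(2)[of "\<theta> w"] by (simp add: V_def)
  have "slope_gap (rho w) = 1 / V - (\<beta> * dlt_total C1 C2)\<^sup>2 * (rho w * (1 - rho w))"
    unfolding rho_variance V_def by (simp add: slope_gap_def theta_def phi_def)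
  then have "- slope_gap (rho w) * V = (\<beta> * dlt_total C1 C2)\<^sup>2 * (rho w * (1 - rho w)) * V - 1"
    using nz by (simp add: left_diff_distrib)
  then show ?thesis
    by (simp add: deriv_psi deriv_theta power2_eq_square flip: V_def)
qed

lemma deriv_psi_ge_1_iff: "deriv \<psi> w \<ge> 1 \<longleftrightarrow> slope_gap (rho w) \<le> 0"
  and deriv_psi_gt_1_iff: "deriv \<psi> w > 1 \<longleftrightarrow> slope_gap (rho w) < 0"
proof -
  define V where "V = rho (\<theta> w) * (1 - rho (\<theta> w))"
  have "V > 0"
    using rho_bounds(1)[of "\<theta> w"] rho_bounds(2)[of "\<theta> w"] by (simp add: V_def)
  moreover have "deriv \<psi> w = 1 - slope_gap (rho w) * V"
    using deriv_psi_gap[of w] by (simp add: V_def)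
  ultimately show "deriv \<psi> w \<ge> 1 \<longleftrightarrow> slope_gap (rho w) \<le> 0"
    and "deriv \<psi> w > 1 \<longleftrightarrow> slope_gap (rho w) < 0"
    by (simp_all add: mult_le_0_iff mult_less_0_iff)
qed

text \<open>The two exponentials are convex in \<open>t\<close>, and the quadratic term is strictly convex unless all
  \<open>\<delta>\<^sup>r\<close> vanish together.\<close>
lemma slope_gap_strictly_convex:
  assumes "s < t" and "t < u" and "slope_gap s \<le> 0" and "slope_gap u \<le> 0"
    and D: "dlt_total C1 C2 \<noteq> 0"
  shows "slope_gap t < 0"
proof -
  define \<mu> where "\<mu> = (t - s) / (u - s)"
  have \<mu>: "0 < \<mu>" "\<mu> < 1"
    using assms(1,2) by (simp_all add: \<mu>_def)
  have "\<mu> * (u - s) = t - s"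
    using assms(1,2) by (simp add: \<mu>_def)
  then have t: "t = (1 - \<mu>) * s + \<mu> * u"
    by (simp add: algebra_simps)
  define z where "z x = \<beta> * (kappa C1 C2 + dlt_total C1 C2 * x)" for x
  have zt: "z t = (1 - \<mu>) * z s + \<mu> * z u"
    unfolding z_def t by (simp add: algebra_simps)
  have e1: "exp (z t) \<le> (1 - \<mu>) * exp (z s) + \<mu> * exp (z u)"
    using convex_onD[OF exp_convex, of \<mu> "z s" "z u"] \<mu> by (simp add: zt)
  have e2: "exp (- z t) \<le> (1 - \<mu>) * exp (- z s) + \<mu> * exp (- z u)"
    using convex_onD[OF exp_convex, of \<mu> "- z s" "- z u"] \<mu> by (simp add: zt)
  have "t * (1 - t) = (1 - \<mu>) * (s * (1 - s)) + \<mu> * (u * (1 - u)) + \<mu> * (1 - \<mu>) * (u - s)\<^sup>2"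
    unfolding t by (simp add: algebra_simps power2_eq_square)
  moreover have "\<mu> * (1 - \<mu>) * (u - s)\<^sup>2 > 0"
    using \<mu> assms(1,2) by simp
  ultimately have "(1 - \<mu>) * (s * (1 - s)) + \<mu> * (u * (1 - u)) < t * (1 - t)"
    by linarith
  then have q: "(\<beta> * dlt_total C1 C2)\<^sup>2 * ((1 - \<mu>) * (s * (1 - s)) + \<mu> * (u * (1 - u)))
      < (\<beta> * dlt_total C1 C2)\<^sup>2 * (t * (1 - t))"
    using D beta_pos by (intro mult_strict_left_mono) auto
  have "slope_gap t < (1 - \<mu>) * slope_gap s + \<mu> * slope_gap u"
    using e1 e2 q unfolding slope_gap_def z_def[symmetric]
    by (simp add: algebra_simps)
  also have "\<dots> \<le> 0"
    using \<mu> assms(3,4) by (intro add_nonpos_nonpos mult_nonneg_nonpos) auto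
  finally show ?thesis .
qed

text \<open>This is the form in which convexity enters the counting of fixed points. A slope of at least \<open>1\<close>
  rules out that \<open>\<theta>\<close> is constant, which makes the convexity strict.\<close>
lemma deriv_psi_between:
  assumes "u < v" and "v < w" and u: "deriv \<psi> u \<ge> 1" and w: "deriv \<psi> w \<ge> 1"
  shows "deriv \<psi> v > 1"
proof -
  have "dlt_total C1 C2 \<noteq> 0"
    using u by (auto simp: deriv_psi deriv_theta)
  then show ?thesis
    using slope_gap_strictly_convex[of "rho w" "rho v" "rho u"] assms rho_strict_antimono
    by (simp add: deriv_psi_ge_1_iff deriv_psi_gt_1_iff)
qed

section \<open>Counting the fixed points\<close>

lemma psi_rolle:
  assumes "u < v" and "\<psi> u = u" and "\<psi> v = v"
  obtains s where "u < s" and "s < v" and "deriv \<psi> s = 1"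
proof -
  obtain s where "u < s" "s < v" "\<psi> v - \<psi> u = (v - u) * deriv \<psi> s"
    using MVT2[of u v \<psi> "deriv \<psi>"] assms(1) psi_has_deriv by blast
  with assms that[of s] show thesis
    by simp
qed

text \<open>The inequalities are strict although \<open>\<theta>\<close> is only weakly decreasing: if \<open>\<theta>(w) = \<omega>\<close>, then
  \<open>w = \<psi>(w) = \<theta>(\<omega>) = \<omega>\<close>.\<close>
lemma theta_crosses_wbar:
  assumes "\<psi> w = w"
  shows "w < \<omega> \<Longrightarrow> \<omega> < \<theta> w" and "\<omega> < w \<Longrightarrow> \<theta> w < \<omega>"
proof -
  have "w = \<omega>" if "\<theta> w = \<omega>"
    using assms theta_fixed that by (simp add: psi_def)
  then show "w < \<omega> \<Longrightarrow> \<omega> < \<theta> w" and "\<omega> < w \<Longrightarrow> \<theta> w < \<omega>"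
    using theta_antimono[of w \<omega>] theta_antimono[of \<omega> w] theta_fixed by force+
qed

lemma no_four_fixed_points:
  assumes "t < u" "u < v" "v < w" "\<psi> t = t" "\<psi> u = u" "\<psi> v = v" "\<psi> w = w"
  shows False
proof -
  obtain r1 where r1: "t < r1" "r1 < u" "deriv \<psi> r1 = 1"
    using psi_rolle[of t u] assms by blast
  obtain r2 where r2: "u < r2" "r2 < v" "deriv \<psi> r2 = 1"
    using psi_rolle[of u v] assms by blast
  obtain r3 where r3: "v < r3" "r3 < w" "deriv \<psi> r3 = 1"
    using psi_rolle[of v w] assms by blast
  from deriv_psi_between[of r1 r2 r3] r1 r2 r3 show False
    by simp
qed

text \<open>Each gap contains a point of slope \<open>1\<close>, so the middle fixed point lies between two such points.
  A slope of at least \<open>1\<close> at the smallest fixed point would push the slope at the first of them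
  above \<open>1\<close>.\<close>
lemma deriv_at_three_fixed_points:
  assumes "u < v" "v < w" "\<psi> u = u" "\<psi> v = v" "\<psi> w = w"
  shows "deriv \<psi> v > 1" and "deriv \<psi> u < 1"
proof -
  obtain r where r: "u < r" "r < v" "deriv \<psi> r = 1"
    using psi_rolle[of u v] assms by blast
  obtain s where s: "v < s" "s < w" "deriv \<psi> s = 1"
    using psi_rolle[of v w] assms by blast
  show "deriv \<psi> v > 1"
    using deriv_psi_between[of r v s] r s by simp
  show "deriv \<psi> u < 1"
    using deriv_psi_between[of u r s] r s by fastforce
qed

text \<open>A further fixed point \<open>w\<close> would put \<open>\<omega>\<close> strictly between the fixed points \<open>w\<close> and \<open>\<theta>(w)\<close>, and the
  middle one of three has slope above \<open>1\<close>.\<close>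
lemma psi_fixed_unique:
  assumes "deriv \<psi> \<omega> \<le> 1" and w: "\<psi> w = w"
  shows "w = \<omega>"
proof (rule ccontr)
  assume "w \<noteq> \<omega>"
  then have "w < \<omega> \<and> \<omega> < \<theta> w \<or> \<theta> w < \<omega> \<and> \<omega> < w"
    using theta_crosses_wbar[OF w] by linarith
  then have "deriv \<psi> \<omega> > 1"
    using deriv_at_three_fixed_points(1)[of _ \<omega>] w psi_fixed psi_fixed_theta[OF w] by blast
  with assms(1) show False by simp
qed

text \<open>Because of the slope at \<open>\<omega>\<close>, the graph of \<open>\<psi>\<close> lies below the diagonal just to the left of \<open>\<omega>\<close>;
  being bounded below, \<open>\<psi>\<close> must meet the diagonal further left. Its image under \<open>\<theta>\<close> is the third fixed
  point.\<close>
lemma psi_three_fixed_points: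
  assumes "deriv \<psi> \<omega> > 1"
  obtains w where "w < \<omega>" and "\<omega> < \<theta> w" and "{v. \<psi> v = v} = {w, \<omega>, \<theta> w}"
    and "deriv \<psi> w < 1"
proof -
  have lo: "\<beta> * kappa C1 C2 \<le> \<theta> v" for v
    using rho_bounds(1)[of v] dlt_total_nonneg beta_pos by (simp add: theta_def phi_def)
  have "((\<lambda>v. \<psi> v - v) has_real_derivative deriv \<psi> \<omega> - 1) (at \<omega>)"
    by (auto intro!: derivative_eq_intros psi_has_deriv)
  from DERIV_pos_inc_left[OF this] assms
  obtain d where d: "d > 0" "\<And>h. h > 0 \<Longrightarrow> h < d \<Longrightarrow> \<psi> (\<omega> - h) - (\<omega> - h) < \<psi> \<omega> - \<omega>"
    by auto
  define u where "u = \<omega> - d / 2"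
  have u: "u < \<omega>" "\<psi> u < u"
    using d(1) d(2)[of "d / 2"] by (auto simp: u_def psi_fixed)
  \<comment> \<open>The lower bound \<open>\<beta>\<kappa>\<close> of \<open>\<psi>\<close> is the left end for the intermediate value theorem; it is at most \<open>u\<close>
    because \<open>\<psi>(u) < u\<close>.\<close>
  have "\<beta> * kappa C1 C2 \<le> \<psi> v" for v
    using lo by (simp add: psi_def)
  from this[of u] this[of "\<beta> * kappa C1 C2"] u
  have *: "\<beta> * kappa C1 C2 \<le> u" "\<psi> u - u \<le> 0" "0 \<le> \<psi> (\<beta> * kappa C1 C2) - \<beta> * kappa C1 C2"
    by auto
  have "continuous_on {\<beta> * kappa C1 C2..u} (\<lambda>v. \<psi> v - v)"
    by (intro continuous_on_diff continuous_on_id DERIV_continuous_on)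
      (rule has_field_derivative_at_within[OF psi_has_deriv])
  from IVT2'[OF *(2,3,1) this] obtain w where "w \<le> u" and w_fixed: "\<psi> w = w"
    by auto
  with u have w: "w < \<omega>" by simp
  have w2: "\<omega> < \<theta> w"
    using theta_crosses_wbar(1)[OF w_fixed w] .
  have "v \<in> {w, \<omega>, \<theta> w}" if v: "\<psi> v = v" for v
  proof (rule ccontr)
    assume "v \<notin> {w, \<omega>, \<theta> w}"
    then consider "v < w" | "w < v" "v < \<omega>" | "\<omega> < v" "v < \<theta> w" | "\<theta> w < v"
      by force
    then show False
      using no_four_fixed_points v w_fixed psi_fixed psi_fixed_theta[OF w_fixed] w w2
      by cases metis+
  qed
  then have "{v. \<psi> v = v} = {w, \<omega>, \<theta> w}"
    using w_fixed psi_fixed psi_fixed_theta[OF w_fixed] by auto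
  moreover have "deriv \<psi> w < 1"
    using deriv_at_three_fixed_points(2)[OF w w2 w_fixed psi_fixed psi_fixed_theta[OF w_fixed]] .
  ultimately show thesis
    using that w w2 by blast
qed

section \<open>Rest points as fixed points\<close>

definition fixed_point_state :: "real \<Rightarrow> state" where
  "fixed_point_state w = state_of_probs C1 C2 (rho w) (rho (\<theta> w))"

lemma fixed_point_state_wbar: "fixed_point_state \<omega> = xbar C1 C2 \<beta>"
  by (simp add: fixed_point_state_def xbar_def theta_fixed)

lemma logit_state_of_probs:
  "logit \<beta> (state_of_probs C1 C2 p (rho w)) Player1 Route_a = rho (\<theta> w)"
  "logit \<beta> (state_of_probs C1 C2 (rho w) p) Player2 Route_a = rho (\<theta> w)"
  unfolding logit_route_a theta_def phi_def
  by (auto simp: state_of_probs_def kappa_def dlt_total_def algebra_simps)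

lemma logit_fixed_point_state:
  assumes "\<psi> w = w"
  shows "logit \<beta> (fixed_point_state w) Player1 Route_a = rho w"
    and "logit \<beta> (fixed_point_state w) Player2 Route_a = rho (\<theta> w)"
  using assms logit_state_of_probs(1)[of _ "\<theta> w"] logit_state_of_probs(2)[of w]
  by (simp_all add: fixed_point_state_def psi_def)

lemma state_eq_iff: "x = y \<longleftrightarrow> (\<forall>i r. x $ (i, r) = (y :: state) $ (i, r))"
  by (simp add: vec_eq_iff)

lemma rest_point_iff_probs:
  "rest_point C1 C2 \<beta> x \<longleftrightarrow>
     x = state_of_probs C1 C2 (logit \<beta> x Player1 Route_a) (logit \<beta> x Player2 Route_a)"
proof -
  have "state_of_probs C1 C2 (logit \<beta> x Player1 Route_a) (logit \<beta> x Player2 Route_a) $ (i, r)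
      = cost C1 C2 \<beta> x i r" for i r
    by (cases i; cases r)
      (simp_all add: cost_def state_of_probs_def logit_route_b dlt_def algebra_simps)
  then show ?thesis
    by (simp add: rest_point_def state_eq_iff)
qed

text \<open>The Logit probability of the first route is \<open>\<rho>(w\<^sub>i)\<close> with \<open>w\<^sub>i = \<beta>(x\<^sup>i\<^sup>a - x\<^sup>i\<^sup>b)\<close>, and the rest point
  equations for player \<open>i\<close> give \<open>w\<^sub>i = \<theta>(w\<^sub>j)\<close>. The parameter \<open>w\<close> is \<open>w\<^sub>1\<close>.\<close>
lemma rest_point_iff_fixed_point:
  "rest_point C1 C2 \<beta> x \<longleftrightarrow> (\<exists>w. \<psi> w = w \<and> x = fixed_point_state w)"
proof
  assume x: "rest_point C1 C2 \<beta> x"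
  define w where "w i = \<beta> * (x $ (i, Route_a) - x $ (i, Route_b))" for i
  have lw: "logit \<beta> x i Route_a = rho (w i)" for i
    by (simp add: logit_route_a w_def)
  have xs: "x = state_of_probs C1 C2 (rho (w Player1)) (rho (w Player2))"
    using x unfolding rest_point_iff_probs lw .
  have w1: "\<theta> (w Player2) = w Player1"
    using logit_state_of_probs(1)[of "rho (w Player1)" "w Player2"]
    unfolding xs[symmetric] lw rho_inject ..
  have w2: "\<theta> (w Player1) = w Player2"
    using logit_state_of_probs(2)[of "w Player1" "rho (w Player2)"]
    unfolding xs[symmetric] lw rho_inject ..
  have "\<psi> (w Player1) = w Player1"
    by (simp add: psi_def w1 w2)
  moreover have "x = fixed_point_state (w Player1)"
    unfolding fixed_point_state_def w2 by (rule xs)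
  ultimately show "\<exists>w. \<psi> w = w \<and> x = fixed_point_state w"
    by blast
next
  assume "\<exists>w. \<psi> w = w \<and> x = fixed_point_state w"
  then obtain w where w: "\<psi> w = w" and x: "x = fixed_point_state w"
    by blast
  show "rest_point C1 C2 \<beta> x"
    unfolding rest_point_iff_probs x logit_fixed_point_state[OF w]
    by (rule fixed_point_state_def)
qed

lemma fixed_point_state_inj:
  assumes "\<psi> v = v" "\<psi> w = w" "fixed_point_state v = fixed_point_state w"
  shows "v = w"
  using logit_fixed_point_state(1)[OF assms(1)]
  unfolding assms(3) logit_fixed_point_state(1)[OF assms(2)] rho_inject by (rule sym)

lemma symmetric_fixed_point_state:
  assumes "\<psi> w = w"
  shows "symmetric_state (fixed_point_state w) \<longleftrightarrow> w = \<omega>"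
proof
  assume "symmetric_state (fixed_point_state w)"
  then have "logit \<beta> (fixed_point_state w) Player1 Route_a = logit \<beta> (fixed_point_state w) Player2 Route_a"
    by (simp add: logit_def symmetric_state_def)
  then have "\<theta> w = w"
    unfolding logit_fixed_point_state[OF assms] rho_inject by (rule sym)
  then show "w = \<omega>"
    by (rule theta_unique)
next
  assume "w = \<omega>"
  then show "symmetric_state (fixed_point_state w)"
    using xbar_symmetric[of C1 C2 \<beta>] unfolding fixed_point_state_wbar[symmetric] by (rule ssubst)
qed

lemma swap_fixed_point_state:
  assumes "\<psi> w = w"
  shows "swap_players (fixed_point_state w) = fixed_point_state (\<theta> w)"
  unfolding state_eq_iff
proof (intro allI)
  fix i r
  have "\<theta> (\<theta> w) = w"
    using assms by (simp add: psi_def)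
  then show "swap_players (fixed_point_state w) $ (i, r) = fixed_point_state (\<theta> w) $ (i, r)"
    by (cases i; cases r) (simp_all add: swap_players_def fixed_point_state_def state_of_probs_def)
qed


section \<open>The linearized dynamics\<close>

lemma logit_bounds: "logit \<beta> x i r > 0" "logit \<beta> x i r < 1"
  using rho_bounds by (cases r; simp add: logit_route_b logit_route_a)+

definition route_sign :: "route \<Rightarrow> real" where
  "route_sign r = (case r of Route_a \<Rightarrow> -1 | Route_b \<Rightarrow> 1)"

definition logit_slope :: "state \<Rightarrow> player \<Rightarrow> real" where
  "logit_slope x i = \<beta> * (logit \<beta> x i Route_a * logit \<beta> x i Route_b)"

lemma logit_slope_pos: "logit_slope x i > 0"
  using logit_bounds beta_pos by (simp add: logit_slope_def)

lemma has_derivative_coordinate: "((\<lambda>y :: state. y $ k) has_derivative (\<lambda>h. h $ k)) (at x)"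
  by (rule bounded_linear.has_derivative[OF bounded_linear_vec_nth has_derivative_ident])

lemma has_derivative_logit:
  "((\<lambda>y. logit \<beta> y i r) has_derivative
     (\<lambda>h. route_sign r * logit_slope x i * (h $ (i, Route_a) - h $ (i, Route_b)))) (at x)"
proof -
  have "((\<lambda>y. \<beta> * (y $ (i, Route_a) - y $ (i, Route_b))) has_derivative
      (\<lambda>h. \<beta> * (h $ (i, Route_a) - h $ (i, Route_b)))) (at x)"
    by (intro has_derivative_mult_right has_derivative_diff has_derivative_coordinate)
  note DERIV_compose_FDERIV[OF rho_deriv this]
  then have a: "((\<lambda>y. logit \<beta> y i Route_a) has_derivative
      (\<lambda>h. - (logit_slope x i * (h $ (i, Route_a) - h $ (i, Route_b))))) (at x)"
    by (simp add: logit_slope_def logit_route_b logit_route_a mult_ac)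
  have "((\<lambda>y. logit \<beta> y i Route_b) has_derivative
      (\<lambda>h. logit_slope x i * (h $ (i, Route_a) - h $ (i, Route_b)))) (at x)"
    unfolding logit_route_b using has_derivative_diff[OF has_derivative_const[of 1] a] by simp
  with a show ?thesis
    by (cases r) (simp_all add: route_sign_def)
qed

definition linearization :: "state \<Rightarrow> state \<Rightarrow> state" where
  "linearization x h = (\<chi> k. case k of (i, r) \<Rightarrow>
     logit \<beta> x i r *
       (dlt C1 C2 r * (route_sign r * logit_slope x (other i) *
          (h $ (other i, Route_a) - h $ (other i, Route_b))) - h $ (i, r)))"

text \<open>At a rest point \<open>C\<^sup>i\<^sup>r - x\<^sup>i\<^sup>r = 0\<close>, so the product rule leaves only the derivative of the second
  factor.\<close>
lemma mean_field_has_derivative: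
  assumes "rest_point C1 C2 \<beta> x"
  shows "(mean_field C1 C2 \<beta> has_derivative linearization x) (at x)"
proof -
  have "((\<lambda>y. logit \<beta> y i r * (cost C1 C2 \<beta> y i r - y $ (i, r))) has_derivative
      (\<lambda>h. linearization x h $ (i, r))) (at x)" for i r
  proof -
    have "((\<lambda>y. cost C1 C2 \<beta> y i r - y $ (i, r)) has_derivative
        (\<lambda>h. 0 + dlt C1 C2 r * (route_sign r * logit_slope x (other i) *
          (h $ (other i, Route_a) - h $ (other i, Route_b))) - h $ (i, r))) (at x)"
      unfolding cost_def
      by (intro has_derivative_diff has_derivative_add has_derivative_const
          has_derivative_mult_right has_derivative_logit has_derivative_coordinate)
    from has_derivative_mult[OF has_derivative_logit[of i r] this]
    show ?thesis
      using assms by (simp add: rest_point_def linearization_def)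
  qed
  then have "((\<lambda>y. mean_field C1 C2 \<beta> y $ k) has_derivative (\<lambda>h. linearization x h $ k)) (at x)" for k
    by (cases k) (simp add: mean_field_def)
  then show ?thesis
    by (subst has_derivative_componentwise_within) (auto simp: Basis_vec_def inner_axis)
qed

lemma sum_state_index: "(\<Sum>k\<in>UNIV. f k) = (\<Sum>i\<in>{Player1, Player2}. \<Sum>r\<in>{Route_a, Route_b}. f (i, r))"
  for f :: "player \<times> route \<Rightarrow> 'b :: comm_monoid_add"
  unfolding UNIV_Times_UNIV[symmetric] UNIV_player[symmetric] UNIV_route[symmetric]
  by (simp add: sum.cartesian_product)

lemma jacobian_mult:
  assumes "rest_point C1 C2 \<beta> x"
  shows "(map_matrix complex_of_real (jacobian (mean_field C1 C2 \<beta>) (at x)) *v v) $ (i, r) =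
    of_real (logit \<beta> x i r) *
      (of_real (dlt C1 C2 r * route_sign r * logit_slope x (other i)) *
        (v $ (other i, Route_a) - v $ (other i, Route_b)) - v $ (i, r))"
proof -
  have "frechet_derivative (mean_field C1 C2 \<beta>) (at x) = linearization x"
    using frechet_derivative_at[OF mean_field_has_derivative[OF assms]] by simp
  then show ?thesis
    unfolding matrix_vector_mult_def sum_state_index
    by (cases i; cases r)
      (simp_all add: jacobian_def matrix_def linearization_def axis_def algebra_simps)
qed

text \<open>The diagonal part is moved to the left, so that each coordinate of an eigenvector is expressed
  through the difference of the other player's coordinates.\<close>
lemma complex_eigenvalue_iff:
  assumes "rest_point C1 C2 \<beta> x"
  shows "complex_eigenvalue (jacobian (mean_field C1 C2 \<beta>) (at x)) l \<longleftrightarrow>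
    (\<exists>v :: complex ^ (player \<times> route). v \<noteq> 0 \<and> (\<forall>i r.
       (l + of_real (logit \<beta> x i r)) * v $ (i, r) =
       of_real (logit \<beta> x i r * (dlt C1 C2 r * route_sign r * logit_slope x (other i))) *
         (v $ (other i, Route_a) - v $ (other i, Route_b))))"
proof -
  have rearrange: "p * (c * d - e) = l * e \<longleftrightarrow> (l + p) * e = p * c * d" for p c d e :: complex
    by (auto simp: algebra_simps)
  show ?thesis
    unfolding complex_eigenvalue_def vec_eq_iff[of "_ *v _"] split_paired_All
      jacobian_mult[OF assms] vector_smult_component rearrange of_real_mult ..
qed

section \<open>The stability criterion\<close>

text \<open>If \<open>\<pi>\<^sup>i\<^sup>a = \<rho>(w\<^sub>i)\<close>, this is \<open>-\<theta>'(w\<^sub>i)\<close>.\<close>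
definition coupling :: "state \<Rightarrow> player \<Rightarrow> real" where
  "coupling x i = dlt_total C1 C2 * logit_slope x i"

lemma coupling_nonneg: "coupling x i \<ge> 0"
  using dlt_total_nonneg logit_slope_pos[of x i] by (simp add: coupling_def)

text \<open>An eigenvalue in the closed right half-plane satisfies \<open>|\<pi> / (l + \<pi>)| \<le> 1\<close> for every Logit
  probability \<open>\<pi>\<close>. The difference of one player's coordinates in an eigenvector is then at most the
  other player's difference times that player's coupling, and going round once contracts strictly.\<close>
lemma stable_if_coupling_less_1:
  assumes x: "rest_point C1 C2 \<beta> x" and less: "coupling x Player1 * coupling x Player2 < 1"
  shows "stable_rest_point C1 C2 \<beta> x"
  unfolding stable_rest_point_def
proof (intro conjI x allI impI)
  fix l
  assume "complex_eigenvalue (jacobian (mean_field C1 C2 \<beta>) (at x)) l"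
  then obtain v :: "complex ^ (player \<times> route)" where "v \<noteq> 0" and
    v: "\<And>i r. (l + of_real (logit \<beta> x i r)) * v $ (i, r) =
       of_real (logit \<beta> x i r * (dlt C1 C2 r * route_sign r * logit_slope x (other i))) *
         (v $ (other i, Route_a) - v $ (other i, Route_b))"
    unfolding complex_eigenvalue_iff[OF x] by blast
  define u where "u i = norm (v $ (i, Route_a) - v $ (i, Route_b))" for i
  show "Re l < 0"
  proof (rule ccontr)
    assume "\<not> Re l < 0"
    then have l: "Re l \<ge> 0" by simp
    have bound: "norm (v $ (i, r)) \<le> dlt C1 C2 r * logit_slope x (other i) * u (other i)" for i r
    proof -
      let ?p = "logit \<beta> x i r"
      have p: "?p > 0" by (rule logit_bounds)
      have "?p \<le> norm (l + of_real ?p)"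
        using complex_Re_le_cmod[of "l + of_real ?p"] l by simp
      then have "?p * norm (v $ (i, r)) \<le> norm ((l + of_real ?p) * v $ (i, r))"
        by (simp add: norm_mult mult_right_mono)
      also have "\<dots> = ?p * (dlt C1 C2 r * logit_slope x (other i) * u (other i))"
        unfolding v using p dlt_nonneg[of r] logit_slope_pos[of x "other i"]
        by (cases r) (simp_all add: norm_mult u_def route_sign_def abs_mult)
      finally show ?thesis
        using p by simp
    qed
    have contract: "u i \<le> coupling x (other i) * u (other i)" for i
    proof -
      have "u i \<le> norm (v $ (i, Route_a)) + norm (v $ (i, Route_b))"
        unfolding u_def by (rule norm_triangle_ineq4)
      also have "\<dots> \<le> coupling x (other i) * u (other i)"
        using bound[of i Route_a] bound[of i Route_b]
        by (simp add: coupling_def dlt_total_def algebra_simps)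
      finally show ?thesis .
    qed
    have u_nonneg: "u i \<ge> 0" for i
      by (simp add: u_def)
    have "u Player1 \<le> coupling x Player2 * (coupling x Player1 * u Player1)"
      using contract[of Player1] mult_left_mono[OF contract[of Player2] coupling_nonneg[of x Player2]]
      by simp
    then have "u Player1 \<le> coupling x Player1 * coupling x Player2 * u Player1"
      by (simp add: mult_ac)
    then have "\<not> u Player1 > 0"
      using mult_strict_right_mono[OF less, of "u Player1"] by linarith
    then have "u Player1 = 0"
      using u_nonneg[of Player1] by simp
    moreover from this have "u Player2 = 0"
      using contract[of Player2] u_nonneg[of Player2] by simp
    ultimately have "u i = 0" for i
      by (cases i) auto
    then have "v $ (i, r) = 0" for i r
      using bound[of i r] by simp
    then have "v = 0"
      by (simp add: vec_eq_iff)
    with \<open>v \<noteq> 0\<close> show False ..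
  qed
qed

text \<open>An eigenvector \<open>v\<close> for the real eigenvalue \<open>l \<ge> 0\<close> satisfies
  \<open>v\<^sup>i\<^sup>a - v\<^sup>i\<^sup>b = - s\<^sub>j g\<^sub>i (v\<^sup>j\<^sup>a - v\<^sup>j\<^sup>b)\<close>, with \<open>s\<^sub>j\<close> the slope \<open>\<beta> \<pi>\<^sup>j\<^sup>a \<pi>\<^sup>j\<^sup>b\<close> of the other player; this
  is the factor \<open>g\<^sub>i\<close>.\<close>
definition response :: "state \<Rightarrow> real \<Rightarrow> player \<Rightarrow> real" where
  "response x l i = (\<Sum>r\<in>UNIV. logit \<beta> x i r * dlt C1 C2 r / (l + logit \<beta> x i r))"

lemma response_simps:
  "response x l i = logit \<beta> x i Route_a * dlt C1 C2 Route_a / (l + logit \<beta> x i Route_a)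
     + logit \<beta> x i Route_b * dlt C1 C2 Route_b / (l + logit \<beta> x i Route_b)"
  by (simp add: response_def UNIV_route)

lemma response_0: "response x 0 i = dlt_total C1 C2"
  using logit_bounds(1)[of x i] by (simp add: response_simps dlt_total_def less_imp_neq[THEN not_sym])

lemma response_bounds:
  assumes "l \<ge> 0"
  shows "0 \<le> response x l i" and "response x l i \<le> dlt_total C1 C2 / (l + 1)"
proof -
  have pos: "logit \<beta> x i r > 0" "logit \<beta> x i r \<le> 1" for r
    using logit_bounds[of x i r] by auto
  show "0 \<le> response x l i"
    unfolding response_def using pos dlt_nonneg assms
    by (intro sum_nonneg divide_nonneg_pos mult_nonneg_nonneg) (auto intro: add_nonneg_pos less_imp_le)
  have "logit \<beta> x i r * dlt C1 C2 r / (l + logit \<beta> x i r) \<le> dlt C1 C2 r / (l + 1)" for r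
  proof -
    have "logit \<beta> x i r * (l + 1) \<le> l + logit \<beta> x i r"
      using mult_right_mono[OF pos(2)[of r] assms] by (simp add: algebra_simps)
    then have "logit \<beta> x i r / (l + logit \<beta> x i r) \<le> 1 / (l + 1)"
      using pos(1)[of r] assms by (simp add: frac_le_eq divide_simps)
    from mult_right_mono[OF this dlt_nonneg[of r]] show ?thesis
      by simp
  qed
  from this[of Route_a] this[of Route_b]
  show "response x l i \<le> dlt_total C1 C2 / (l + 1)"
    by (simp add: response_simps dlt_total_def add_divide_distrib)
qed

text \<open>The hypothesis is the compatibility condition for the two equations that relate the differences
  \<open>u\<^sub>1\<close> and \<open>u\<^sub>2\<close> of an eigenvector: starting from \<open>u\<^sub>2 = 1\<close> one returns to \<open>1\<close> after going round
  once.\<close>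
lemma eigenvalue_if_response:
  assumes x: "rest_point C1 C2 \<beta> x" and l: "l \<ge> 0"
    and one: "logit_slope x Player1 * response x l Player2 * (logit_slope x Player2 * response x l Player1) = 1"
  shows "complex_eigenvalue (jacobian (mean_field C1 C2 \<beta>) (at x)) (of_real l)"
proof -
  define u where "u i = (case i of Player1 \<Rightarrow> - (logit_slope x Player2 * response x l Player1)
      | Player2 \<Rightarrow> 1)" for i
  define h where "h i r = logit \<beta> x i r * (dlt C1 C2 r * route_sign r * logit_slope x (other i))
      * u (other i) / (l + logit \<beta> x i r)" for i r
  define v :: "complex ^ (player \<times> route)" where "v = (\<chi> k. of_real (h (fst k) (snd k)))"
  have nz: "l + logit \<beta> x i r \<noteq> 0" for i r
    using logit_bounds(1)[of x i r] l by linarith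
  have "h i Route_a - h i Route_b = - (logit_slope x (other i) * response x l i) * u (other i)" for i
    by (simp add: h_def response_simps route_sign_def algebra_simps)
  then have hu: "h i Route_a - h i Route_b = u i" for i
    using one by (cases i) (simp_all add: u_def)
  have "(complex_of_real l + of_real (logit \<beta> x i r)) * v $ (i, r) =
       of_real (logit \<beta> x i r * (dlt C1 C2 r * route_sign r * logit_slope x (other i))) *
         (v $ (other i, Route_a) - v $ (other i, Route_b))" for i r
  proof -
    have "(l + logit \<beta> x i r) * h i r =
        logit \<beta> x i r * (dlt C1 C2 r * route_sign r * logit_slope x (other i)) *
          (h (other i) Route_a - h (other i) Route_b)"
      unfolding hu using nz[of i r] by (simp add: h_def)
    then show ?thesis
      unfolding v_def by (simp flip: of_real_add of_real_diff of_real_mult)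
  qed
  moreover have "v \<noteq> 0"
  proof
    assume "v = 0"
    then have "h i r = 0" for i r
      by (simp add: v_def vec_eq_iff)
    with hu[of Player2] show False
      by (simp add: u_def)
  qed
  ultimately show ?thesis
    unfolding complex_eigenvalue_iff[OF x] by blast
qed

text \<open>The expression in the compatibility condition equals the product \<open>K\<close> of the couplings at \<open>l = 0\<close>
  and is at most \<open>K / (l + 1)\<^sup>2\<close>. At \<open>l = K\<close> it is therefore at most \<open>1\<close>, so it takes the value \<open>1\<close>
  on \<open>[0, K]\<close>.\<close>
lemma not_stable_if_coupling_ge_1:
  assumes x: "rest_point C1 C2 \<beta> x" and ge: "coupling x Player1 * coupling x Player2 \<ge> 1"
  shows "\<not> stable_rest_point C1 C2 \<beta> x"
proof -
  let ?K = "coupling x Player1 * coupling x Player2"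
  define F where "F l = logit_slope x Player1 * response x l Player2
      * (logit_slope x Player2 * response x l Player1)" for l
  have F0: "F 0 = ?K"
    by (simp add: F_def response_0 coupling_def)
  have "F ?K \<le> 1"
  proof -
    have bound: "logit_slope x i * response x ?K j \<le> coupling x i / (?K + 1)"
      "0 \<le> logit_slope x i * response x ?K j" for i j
      using response_bounds[of ?K x j] ge logit_slope_pos[of x i]
        mult_left_mono[of "response x ?K j" "dlt_total C1 C2 / (?K + 1)" "logit_slope x i"]
      by (simp_all add: coupling_def mult_ac)
    have "F ?K \<le> (coupling x Player1 / (?K + 1)) * (coupling x Player2 / (?K + 1))"
      unfolding F_def using coupling_nonneg ge by (intro mult_mono bound) auto
    also have "\<dots> = (?K / (?K + 1)) * (1 / (?K + 1))"
      by simp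
    also have "\<dots> \<le> 1 * 1"
      using ge by (intro mult_mono) auto
    finally show ?thesis by simp
  qed
  moreover have "continuous_on {0..?K} F"
    unfolding F_def response_simps using logit_bounds(1)
    by (intro continuous_intros ballI) (smt (verit) atLeastAtMost_iff)+
  ultimately obtain l where l: "l \<ge> 0" "F l = 1"
    using IVT2'[of F ?K 1 0] F0 ge by auto
  then have "complex_eigenvalue (jacobian (mean_field C1 C2 \<beta>) (at x)) (of_real l)"
    by (intro eigenvalue_if_response[OF x]) (simp_all add: F_def)
  then show ?thesis
    using l(1) by (auto simp: stable_rest_point_def)
qed

lemma stable_fixed_point_state_iff:
  assumes "\<psi> w = w"
  shows "stable_rest_point C1 C2 \<beta> (fixed_point_state w) \<longleftrightarrow> deriv \<psi> w < 1"
proof -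
  let ?x = "fixed_point_state w"
  have "coupling ?x Player1 * coupling ?x Player2 = deriv \<psi> w"
    by (simp add: coupling_def logit_slope_def logit_route_b logit_fixed_point_state[OF assms]
        deriv_psi deriv_theta)
  moreover have "rest_point C1 C2 \<beta> ?x"
    using assms rest_point_iff_fixed_point by blast
  ultimately show ?thesis
    using stable_if_coupling_less_1[of ?x] not_stable_if_coupling_ge_1[of ?x] by force
qed

end

section \<open>Rest points and their stability\<close>

theorem theorem5:
  fixes C1 C2 :: "route \<Rightarrow> real" and \<beta> :: real
  assumes "\<And>r. C1 r \<le> C2 r" and "\<beta> > 0"
  shows
    "(deriv (psi C1 C2 \<beta>) (wbar C1 C2 \<beta>) \<le> 1 \<longrightarrow>
       {w. psi C1 C2 \<beta> w = w} = {wbar C1 C2 \<beta>} \<and>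
       {x. rest_point C1 C2 \<beta> x} = {xbar C1 C2 \<beta>} \<and>
       (stable_rest_point C1 C2 \<beta> (xbar C1 C2 \<beta>) \<longleftrightarrow>
          deriv (psi C1 C2 \<beta>) (wbar C1 C2 \<beta>) < 1))
     \<and>
     (deriv (psi C1 C2 \<beta>) (wbar C1 C2 \<beta>) > 1 \<longrightarrow>
       (\<exists>w1 w2.
          w1 < wbar C1 C2 \<beta> \<and> wbar C1 C2 \<beta> < w2 \<and>
          {w. psi C1 C2 \<beta> w = w} = {w1, wbar C1 C2 \<beta>, w2} \<and>
          w1 = theta C1 C2 \<beta> w2 \<and> w2 = theta C1 C2 \<beta> w1 \<and>
          deriv (psi C1 C2 \<beta>) w1 = deriv (psi C1 C2 \<beta>) w2 \<and>
          deriv (psi C1 C2 \<beta>) w2 = deriv (theta C1 C2 \<beta>) w1 * deriv (theta C1 C2 \<beta>) w2 \<and>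
          deriv (theta C1 C2 \<beta>) w1 * deriv (theta C1 C2 \<beta>) w2 < 1 \<and>
          symmetric_state (xbar C1 C2 \<beta>) \<and>
          unstable_rest_point C1 C2 \<beta> (xbar C1 C2 \<beta>) \<and>
          (\<exists>x1 x2.
             x1 \<noteq> x2 \<and>
             {x. stable_rest_point C1 C2 \<beta> x \<and> \<not> symmetric_state x} = {x1, x2} \<and>
             {x. rest_point C1 C2 \<beta> x \<and>
                 logit \<beta> x Player1 Route_a = rho w1 \<and>
                 logit \<beta> x Player2 Route_a = rho w2} = {x1} \<and>
             x2 = swap_players x1)))"
proof (intro conjI impI)
  interpret traffic_game C1 C2 \<beta>
    using assms by unfold_locales
  {
    assume le: "deriv \<psi> \<omega> \<le> 1"
    show fixed: "{w. \<psi> w = w} = {\<omega>}"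
      using psi_fixed_unique[OF le] psi_fixed by blast
    show "{x. rest_point C1 C2 \<beta> x} = {xbar C1 C2 \<beta>}"
      unfolding rest_point_iff_fixed_point fixed_point_state_wbar[symmetric]
      using fixed by (simp add: set_eq_iff)
    show "stable_rest_point C1 C2 \<beta> (xbar C1 C2 \<beta>) \<longleftrightarrow> deriv \<psi> \<omega> < 1"
      unfolding fixed_point_state_wbar[symmetric] by (rule stable_fixed_point_state_iff[OF psi_fixed])
  }
  assume gt: "deriv \<psi> \<omega> > 1"
  obtain w where w: "w < \<omega>" "\<omega> < \<theta> w" and fixed: "{v. \<psi> v = v} = {w, \<omega>, \<theta> w}"
    and less: "deriv \<psi> w < 1"
    using psi_three_fixed_points[OF gt] by blast
  let ?X = fixed_point_state
  have fw: "\<psi> w = w" "\<psi> (\<theta> w) = \<theta> w" and theta2: "\<theta> (\<theta> w) = w"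
    using fixed by (auto simp: psi_def)
  have deriv2: "deriv \<psi> (\<theta> w) = deriv \<psi> w"
    by (simp add: deriv_psi theta2)
  have neq: "?X w \<noteq> ?X (\<theta> w)"
    using fixed_point_state_inj[OF fw] w by auto
  have nonsym: "{x. stable_rest_point C1 C2 \<beta> x \<and> \<not> symmetric_state x} = {?X w, ?X (\<theta> w)}"
  proof (intro equalityI subsetI)
    fix x
    assume "x \<in> {x. stable_rest_point C1 C2 \<beta> x \<and> \<not> symmetric_state x}"
    then have x: "stable_rest_point C1 C2 \<beta> x" "\<not> symmetric_state x"
      by simp_all
    then obtain v where v: "\<psi> v = v" "x = ?X v"
      using rest_point_iff_fixed_point[of x] by (auto simp: stable_rest_point_def)
    have "v \<noteq> \<omega>"
      using x(2) symmetric_fixed_point_state[OF v(1)] v(2) by blast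
    moreover have "v \<in> {w, \<omega>, \<theta> w}"
      using v(1) fixed by blast
    ultimately show "x \<in> {?X w, ?X (\<theta> w)}"
      using v(2) by blast
  next
    fix x
    assume x: "x \<in> {?X w, ?X (\<theta> w)}"
    have "stable_rest_point C1 C2 \<beta> (?X w)" "stable_rest_point C1 C2 \<beta> (?X (\<theta> w))"
      using stable_fixed_point_state_iff[OF fw(1)] stable_fixed_point_state_iff[OF fw(2)]
        less deriv2 by simp_all
    moreover have "\<not> symmetric_state (?X w)" "\<not> symmetric_state (?X (\<theta> w))"
      using symmetric_fixed_point_state[OF fw(1)] symmetric_fixed_point_state[OF fw(2)] w
      by simp_all
    ultimately show "x \<in> {x. stable_rest_point C1 C2 \<beta> x \<and> \<not> symmetric_state x}"
      using x by blast
  qed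
  have char: "{x. rest_point C1 C2 \<beta> x \<and> logit \<beta> x Player1 Route_a = rho w \<and>
      logit \<beta> x Player2 Route_a = rho (\<theta> w)} = {?X w}"
  proof (intro equalityI subsetI)
    fix x
    assume "x \<in> {x. rest_point C1 C2 \<beta> x \<and> logit \<beta> x Player1 Route_a = rho w \<and>
      logit \<beta> x Player2 Route_a = rho (\<theta> w)}"
    then have x: "rest_point C1 C2 \<beta> x" and logit:
      "logit \<beta> x Player1 Route_a = rho w" "logit \<beta> x Player2 Route_a = rho (\<theta> w)"
      by simp_all
    from rest_point_iff_probs[THEN iffD1, OF x] show "x \<in> {?X w}"
      unfolding logit fixed_point_state_def by blast
  next
    fix x
    assume "x \<in> {?X w}"
    then show "x \<in> {x. rest_point C1 C2 \<beta> x \<and> logit \<beta> x Player1 Route_a = rho w \<and>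
      logit \<beta> x Player2 Route_a = rho (\<theta> w)}"
      using fw(1) logit_fixed_point_state[OF fw(1)] rest_point_iff_fixed_point[of x] by auto
  qed
  have unstable: "unstable_rest_point C1 C2 \<beta> (xbar C1 C2 \<beta>)"
    unfolding unstable_rest_point_def fixed_point_state_wbar[symmetric]
    using stable_fixed_point_state_iff[OF psi_fixed] gt psi_fixed rest_point_iff_fixed_point by force
  have deriv_w2: "deriv \<psi> (\<theta> w) = deriv \<theta> w * deriv \<theta> (\<theta> w)"
    by (simp add: deriv_psi theta2)
  have deriv_less: "deriv \<theta> w * deriv \<theta> (\<theta> w) < 1"
    using less deriv2 deriv_w2 by simp
  have states: "\<exists>x1 x2.
      x1 \<noteq> x2 \<and>
      {x. stable_rest_point C1 C2 \<beta> x \<and> \<not> symmetric_state x} = {x1, x2} \<and>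
      {x. rest_point C1 C2 \<beta> x \<and> logit \<beta> x Player1 Route_a = rho w \<and>
          logit \<beta> x Player2 Route_a = rho (\<theta> w)} = {x1} \<and>
      x2 = swap_players x1"
    using neq nonsym char swap_fixed_point_state[OF fw(1), symmetric] by blast
  show "\<exists>w1 w2.
          w1 < \<omega> \<and> \<omega> < w2 \<and>
          {w. \<psi> w = w} = {w1, \<omega>, w2} \<and>
          w1 = \<theta> w2 \<and> w2 = \<theta> w1 \<and>
          deriv \<psi> w1 = deriv \<psi> w2 \<and>
          deriv \<psi> w2 = deriv \<theta> w1 * deriv \<theta> w2 \<and>
          deriv \<theta> w1 * deriv \<theta> w2 < 1 \<and>
          symmetric_state (xbar C1 C2 \<beta>) \<and>
          unstable_rest_point C1 C2 \<beta> (xbar C1 C2 \<beta>) \<and>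
          (\<exists>x1 x2.
             x1 \<noteq> x2 \<and>
             {x. stable_rest_point C1 C2 \<beta> x \<and> \<not> symmetric_state x} = {x1, x2} \<and>
             {x. rest_point C1 C2 \<beta> x \<and>
                 logit \<beta> x Player1 Route_a = rho w1 \<and>
                 logit \<beta> x Player2 Route_a = rho w2} = {x1} \<and>
             x2 = swap_players x1)"
    by (rule exI[of _ w], rule exI[of _ "\<theta> w"])
      (rule conjI[OF w(1)] conjI[OF w(2)] conjI[OF fixed] conjI[OF theta2[symmetric]]
        conjI[OF refl] conjI[OF deriv2[symmetric]] conjI[OF deriv_w2] conjI[OF deriv_less]
        conjI[OF xbar_symmetric] conjI[OF unstable] states)+
qed

end
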